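(* Fix an outer iteration $k$ of the Inexact Bregman Sparse Newton (IBSN) algorithm, and let $\{\gamma^{k,v}\}_v$ be the (infinite) sequence of inner iterates generated by it with $\mathbf 1_n^\top\gamma^{k,0}=0$. Write $g^{k,v}=\nabla\mathcal L^k(\gamma^{k,v})$. Then: (i) $\|g^{k,v}\|\to0$ as $v\to\infty$. (ii) $\gamma^{k,v}\to\gamma^{k,\star}$ as $v\to\infty$, where $\gamma^{k,\star}$ is the unique minimizer of $\mathcal L^k$ in the slice $\{\gamma\in\mathbb{R}^n:\mathbf 1_n^\top\gamma=0\}$.
   Context: Data: integers $m,n\ge1$, $C\in\mathbb{R}^{m\times n}$ with nonnegative entries, $a\in\mathbb{R}^m$, $b\in\mathbb{R}^n$ with strictly positive entries and $\sum_i a_i=\sum_j b_j=1$, $\eta>0$, and the $k$-th outer iterate $X^k\in\mathbb{R}^{m\times n}$, which has strictly positive entries ($X^0=ab^\top$). $\|\cdot\|$ is the Euclidean norm. Functions: $$Z^k(\gamma,\zeta)=-a^\top\zeta-b^\top\gamma+\eta\sum_{i,j}X^k_{ij}\exp((\zeta_i+\gamma_j-C_{ij})/\eta),$$ $$\mathcal L^k(\gamma)=-\sum_j\gamma_jb_j+\eta\sum_i a_i\log\Big(\sum_jX^k_{ij}\exp((\gamma_j-C_{ij})/\eta)\Big),$$ $$[P^k(\gamma)]_{ij}=\frac{X^k_{ij}\exp((\gamma_j-C_{ij})/\eta)}{\sum_{l}X^k_{il}\exp((\gamma_l-C_{il})/\eta)},\qquad g^k(\gamma)=\nabla\mathcal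 L^k(\gamma)=P^k(\gamma)^\top a-b .$$ Sparsified Hessian: fix $i^\star\in\arg\max_ia_i$. For $\rho\ge0$ and $P=P^k(\gamma)$, let $[P_\rho]_{ij}=P_{ij}\mathbf 1_{\{P_{ij}\ge\rho\}}/\sum_lP_{il}\mathbf 1_{\{P_{il}\ge\rho\}}$ for $i\ne i^\star$ and $[P_\rho]_{i^\star j}=P_{i^\star j}$, and $H^k_\rho(\gamma)=\frac1\eta(\mathrm{diag}(P_\rho^\top a)-P_\rho^\top\mathrm{diag}(a)P_\rho)$. It is assumed that all normalizing denominators occurring in the run are nonzero. Inner loop of IBSN at outer iteration $k$, started from $(\gamma^{k,0},\zeta^{k,0})$: first run finitely many iterations of the Sinkhorn algorithm (alternating exact minimization of $Z^k$ in $\zeta$ and in $\gamma$) to obtain $\gamma^{k,1}$, and replace $\gamma^{k,1}$ by $\gamma^{k,1}-\frac1n(\mathbf 1_n^\top\gamma^{k,1})\mathbf 1_n$. Then for $v=1,2,\dots$: set $g^{k,v}=g^k(\gamma^{k,v})$, $\rho=\frac{\eta}{mn}\|g^{k,v}\|$, $H^{k,v}_\rho=H^k_\rho(\gamma^{k,v})$, $\Delta\gamma^{k,v}=-(H^{k,v}_\rho+\|g^{k,v}\|I)^{-1}g^{k,v}$ (with $\Delta\gamma^{k,v}=0$ if $g^{k,v}=0$), choose $t^{k,v}$ by Armijo backtracking, i.e. $t^{k,v}$ is the largest element of $\{1,\beta,\beta^2,\dots\}$ with $\mathcal L^k(\gamma^{k,v}+t\Delta\gamma^{k,v})\le\mathcal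 L^k(\gamma^{k,v})+\sigma t\,(g^{k,v})^\top\Delta\gamma^{k,v}$, where $\sigma=10^{-4}$, $\beta=0.8$, and set $\gamma^{k,v+1}=\gamma^{k,v}+t^{k,v}\Delta\gamma^{k,v}$. For this asymptotic statement the inner loop is run indefinitely, i.e. the algorithm's early-termination test is ignored. *)

theory Defs
  imports "HOL-Analysis.Analysis"
begin

text \<open>
  Throughout, \<open>X\<close> is the current outer iterate, i.e. \<open>X\<^sup>k\<close> for the outer index \<open>k\<close> under
  consideration. The index is fixed, so it is not written. The dimensions \<open>m\<close> and \<open>n\<close> are
  \<open>CARD('m)\<close> and \<open>CARD('n)\<close>, and vectors carry the Euclidean norm.
\<close>

definition ibsn_Z ::
  "real^'n^'m \<Rightarrow> real^'m \<Rightarrow> real^'n \<Rightarrow> real \<Rightarrow> real^'n^'m \<Rightarrow> real^'n \<Rightarrow> real^'m \<Rightarrow> real" where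
  "ibsn_Z C a b \<eta> X \<gamma> \<zeta> =
     - (a \<bullet> \<zeta>) - b \<bullet> \<gamma>
     + \<eta> * (\<Sum>i\<in>UNIV. \<Sum>j\<in>UNIV. X $ i $ j * exp ((\<zeta> $ i + \<gamma> $ j - C $ i $ j) / \<eta>))"

definition ibsn_L ::
  "real^'n^'m \<Rightarrow> real^'m \<Rightarrow> real^'n \<Rightarrow> real \<Rightarrow> real^'n^'m \<Rightarrow> real^'n \<Rightarrow> real" where
  "ibsn_L C a b \<eta> X \<gamma> =
     - (\<Sum>j\<in>UNIV. \<gamma> $ j * b $ j)
     + \<eta> * (\<Sum>i\<in>UNIV. a $ i * ln (\<Sum>j\<in>UNIV. X $ i $ j * exp ((\<gamma> $ j - C $ i $ j) / \<eta>)))"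

definition ibsn_P :: "real^'n^'m \<Rightarrow> real \<Rightarrow> real^'n^'m \<Rightarrow> real^'n \<Rightarrow> real^'n^'m" where
  "ibsn_P C \<eta> X \<gamma> =
     (\<chi> i j. X $ i $ j * exp ((\<gamma> $ j - C $ i $ j) / \<eta>)
            / (\<Sum>l\<in>UNIV. X $ i $ l * exp ((\<gamma> $ l - C $ i $ l) / \<eta>)))"

definition gradient :: "('a::real_inner \<Rightarrow> real) \<Rightarrow> 'a \<Rightarrow> 'a" where
  "gradient f x = (THE D. GDERIV f x :> D)"

lemma gradient_eqI:
  assumes "GDERIV f x :> D"
  shows "gradient f x = D"
  unfolding gradient_def
proof (rule the_equality)
  show "GDERIV f x :> D" by fact
next
  fix D' assume "GDERIV f x :> D'"
  then have "(\<lambda>h. inner h D') = (\<lambda>h. inner h D)"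
    using assms has_derivative_unique unfolding gderiv_def by blast
  then have "inner h D' = inner h D" for h by meson
  then show "D' = D"
    by (metis inner_commute vector_eq_ldot)
qed

definition ibsn_g ::
  "real^'n^'m \<Rightarrow> real^'m \<Rightarrow> real^'n \<Rightarrow> real \<Rightarrow> real^'n^'m \<Rightarrow> real^'n \<Rightarrow> real^'n" where
  "ibsn_g C a b \<eta> X \<gamma> = gradient (ibsn_L C a b \<eta> X) \<gamma>"

lemma GDERIV_ibsn_L:
  fixes C X :: "real^'n^'m"
  assumes "\<eta> > 0" and "\<And>i j. X $ i $ j > 0"
  shows "GDERIV (ibsn_L C a b \<eta> X) \<gamma> :> transpose (ibsn_P C \<eta> X \<gamma>) *v a - b"
proof -
  define S where "S i = (\<Sum>l\<in>UNIV. X $ i $ l * exp ((\<gamma> $ l - C $ i $ l) / \<eta>))" for i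
  have S: "S i > 0" for i
    unfolding S_def by (intro sum_pos) (auto simp: assms)
  have nth: "((\<lambda>x::real^'n. x $ j) has_derivative (\<lambda>h. h $ j)) (at \<gamma>)" for j
    by (rule bounded_linear_imp_has_derivative[OF bounded_linear_vec_nth])
  have "((\<lambda>x. \<Sum>j\<in>UNIV. X $ i $ j * exp ((x $ j - C $ i $ j) / \<eta>)) has_derivative
          (\<lambda>h. \<Sum>j\<in>UNIV. X $ i $ j * exp ((\<gamma> $ j - C $ i $ j) / \<eta>) * (h $ j / \<eta>))) (at \<gamma>)" for i
    using assms(1) by (auto intro!: derivative_eq_intros nth simp: fun_eq_iff field_simps)
  from has_derivative_ln[OF S[unfolded S_def] this] have lnd: "((\<lambda>x. ln (\<Sum>j\<in>UNIV. X $ i $ j * exp ((x $ j - C $ i $ j) / \<eta>))) has_derivative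
          (\<lambda>h. inverse (S i) *
             (\<Sum>j\<in>UNIV. X $ i $ j * exp ((\<gamma> $ j - C $ i $ j) / \<eta>) * (h $ j / \<eta>)))) (at \<gamma>)" for i
    unfolding S_def by (simp only: mult.commute)
  have P: "ibsn_P C \<eta> X \<gamma> $ i $ j = X $ i $ j * exp ((\<gamma> $ j - C $ i $ j) / \<eta>) / S i" for i j
    by (simp add: ibsn_P_def S_def)
  have eq: "- (\<Sum>j\<in>UNIV. h $ j * b $ j)
          + \<eta> * (\<Sum>i\<in>UNIV. a $ i * (inverse (S i) *
             (\<Sum>j\<in>UNIV. X $ i $ j * exp ((\<gamma> $ j - C $ i $ j) / \<eta>) * (h $ j / \<eta>))))
        = inner h (transpose (ibsn_P C \<eta> X \<gamma>) *v a - b)" for h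
  proof -
    have "\<eta> * (\<Sum>i\<in>UNIV. a $ i * (inverse (S i) *
             (\<Sum>j\<in>UNIV. X $ i $ j * exp ((\<gamma> $ j - C $ i $ j) / \<eta>) * (h $ j / \<eta>))))
        = (\<Sum>i\<in>UNIV. \<Sum>j\<in>UNIV. h $ j * (ibsn_P C \<eta> X \<gamma> $ i $ j * a $ i))"
      using assms(1) by (simp add: P sum_distrib_left field_simps)
    also have "\<dots> = (\<Sum>j\<in>UNIV. \<Sum>i\<in>UNIV. h $ j * (ibsn_P C \<eta> X \<gamma> $ i $ j * a $ i))"
      by (rule sum.swap)
    finally show ?thesis
      by (simp add: inner_vec_def matrix_vector_mult_def transpose_def sum_distrib_left
          algebra_simps sum_subtractf)
  qed
  show ?thesis
    unfolding gderiv_def ibsn_L_def eq[symmetric]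
    by (intro has_derivative_add has_derivative_minus has_derivative_sum
        has_derivative_mult_right has_derivative_mult_left nth lnd)
qed

lemma ibsn_g_eq:
  fixes C X :: "real^'n^'m"
  assumes "\<eta> > 0" and "\<And>i j. X $ i $ j > 0"
  shows "ibsn_g C a b \<eta> X \<gamma> = transpose (ibsn_P C \<eta> X \<gamma>) *v a - b"
  unfolding ibsn_g_def by (intro gradient_eqI GDERIV_ibsn_L assms)

definition diag_mat :: "real^'k \<Rightarrow> real^'k^'k" where
  "diag_mat v = (\<chi> i j. if i = j then v $ i else 0)"

definition kept_mass :: "real \<Rightarrow> real^'n^'m \<Rightarrow> 'm \<Rightarrow> real" where
  "kept_mass \<rho> P i = (\<Sum>l\<in>UNIV. P $ i $ l * (if P $ i $ l \<ge> \<rho> then 1 else 0))"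

definition sparsify :: "'m \<Rightarrow> real \<Rightarrow> real^'n^'m \<Rightarrow> real^'n^'m" where
  "sparsify istar \<rho> P =
     (\<chi> i j. if i = istar then P $ i $ j
            else P $ i $ j * (if P $ i $ j \<ge> \<rho> then 1 else 0) / kept_mass \<rho> P i)"

definition ibsn_H ::
  "real^'n^'m \<Rightarrow> real^'m \<Rightarrow> real \<Rightarrow> real^'n^'m \<Rightarrow> 'm \<Rightarrow> real \<Rightarrow> real^'n \<Rightarrow> real^'n^'n" where
  "ibsn_H C a \<eta> X istar \<rho> \<gamma> =
     (let Q = sparsify istar \<rho> (ibsn_P C \<eta> X \<gamma>)
      in (1 / \<eta>) *\<^sub>R (diag_mat (transpose Q *v a) - transpose Q ** diag_mat a ** Q))"

definition ibsn_rho ::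
  "real^'n^'m \<Rightarrow> real^'m \<Rightarrow> real^'n \<Rightarrow> real \<Rightarrow> real^'n^'m \<Rightarrow> real^'n \<Rightarrow> real" where
  "ibsn_rho C a b \<eta> X \<gamma> =
     \<eta> / (real CARD('m) * real CARD('n)) * norm (ibsn_g C a b \<eta> X \<gamma>)"

definition ibsn_dir ::
  "real^'n^'m \<Rightarrow> real^'m \<Rightarrow> real^'n \<Rightarrow> real \<Rightarrow> real^'n^'m \<Rightarrow> 'm \<Rightarrow> real^'n \<Rightarrow> real^'n" where
  "ibsn_dir C a b \<eta> X istar \<gamma> =
     (let g = ibsn_g C a b \<eta> X \<gamma>;
          H = ibsn_H C a \<eta> X istar (ibsn_rho C a b \<eta> X \<gamma>) \<gamma>
      in if g = 0 then 0 else - (matrix_inv (H + norm g *\<^sub>R mat 1) *v g))"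

definition armijo_step ::
  "real \<Rightarrow> real \<Rightarrow> ('a::real_inner \<Rightarrow> real) \<Rightarrow> 'a \<Rightarrow> 'a \<Rightarrow> 'a \<Rightarrow> real \<Rightarrow> bool" where
  "armijo_step \<sigma> \<beta> f x g d t \<longleftrightarrow>
     is_arg_max (\<lambda>s. s) (\<lambda>s. s \<in> range (\<lambda>l::nat. \<beta> ^ l) \<and> f (x + s *\<^sub>R d) \<le> f x + \<sigma> * s * (g \<bullet> d)) t"

definition newton_step ::
  "real^'n^'m \<Rightarrow> real^'m \<Rightarrow> real^'n \<Rightarrow> real \<Rightarrow> real^'n^'m \<Rightarrow> 'm \<Rightarrow> real^'n \<Rightarrow> real^'n \<Rightarrow> bool" where
  "newton_step C a b \<eta> X istar \<gamma> \<gamma>' \<longleftrightarrow>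
     (\<exists>t. armijo_step (1 / 10 ^ 4) (4 / 5) (ibsn_L C a b \<eta> X) \<gamma>
            (ibsn_g C a b \<eta> X \<gamma>) (ibsn_dir C a b \<eta> X istar \<gamma>) t
          \<and> \<gamma>' = \<gamma> + t *\<^sub>R ibsn_dir C a b \<eta> X istar \<gamma>)"

text \<open>One Sinkhorn iteration: exact minimization of \<open>Z\<close> in \<open>\<zeta>\<close>, then in \<open>\<gamma>\<close>.\<close>

definition sinkhorn_step ::
  "real^'n^'m \<Rightarrow> real^'m \<Rightarrow> real^'n \<Rightarrow> real \<Rightarrow> real^'n^'m \<Rightarrow>
     (real^'n) \<times> (real^'m) \<Rightarrow> (real^'n) \<times> (real^'m) \<Rightarrow> bool" where
  "sinkhorn_step C a b \<eta> X s s' \<longleftrightarrow>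
     is_arg_min (\<lambda>\<zeta>. ibsn_Z C a b \<eta> X (fst s) \<zeta>) (\<lambda>_. True) (snd s') \<and>
     is_arg_min (\<lambda>\<gamma>. ibsn_Z C a b \<eta> X \<gamma> (snd s')) (\<lambda>_. True) (fst s')"

definition center :: "real^'n \<Rightarrow> real^'n" where
  "center \<gamma> = \<gamma> - (1 / real CARD('n) * (\<Sum>j\<in>UNIV. \<gamma> $ j)) *\<^sub>R 1"

text \<open>
  \<open>\<gamma> v\<close> is the inner iterate \<open>\<gamma>\<^sup>k\<^sup>,\<^sup>v\<close> and \<open>\<zeta>0\<close> is \<open>\<zeta>\<^sup>k\<^sup>,\<^sup>0\<close>. The number of Sinkhorn iterations in the
  first phase is arbitrary but finite, whence the reflexive transitive closure. \<open>\<gamma> 1\<close> is the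
  iterate after centering. The Newton phase never terminates.
\<close>

definition ibsn_inner_run ::
  "real^'n^'m \<Rightarrow> real^'m \<Rightarrow> real^'n \<Rightarrow> real \<Rightarrow> real^'n^'m \<Rightarrow> 'm \<Rightarrow> real^'m \<Rightarrow> (nat \<Rightarrow> real^'n) \<Rightarrow> bool" where
  "ibsn_inner_run C a b \<eta> X istar \<zeta>0 \<gamma> \<longleftrightarrow>
     (\<exists>\<gamma>' \<zeta>'. (sinkhorn_step C a b \<eta> X)\<^sup>*\<^sup>* (\<gamma> 0, \<zeta>0) (\<gamma>', \<zeta>') \<and> \<gamma> 1 = center \<gamma>') \<and>
     (\<forall>v\<ge>1. newton_step C a b \<eta> X istar (\<gamma> v) (\<gamma> (Suc v)))"

end

theory Submission
  imports Defs
begin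

text \<open>
  Write \<open>P = P(\<gamma>)\<close>. Everything rests on the exact increment formula
  \<open>L(\<gamma> + h) = L(\<gamma>) - b \<bullet> h + \<eta> \<Sum>\<^sub>i a\<^sub>i ln (\<Sum>\<^sub>j P\<^sub>i\<^sub>j exp (h\<^sub>j / \<eta>))\<close>: Jensen's inequality gives strict
  convexity modulo constant vectors, and \<open>exp u \<le> 1 + u + 2 u\<^sup>2\<close> for \<open>\<bar>u\<bar> \<le> 1\<close> gives a quadratic upper bound
  for small \<open>h\<close>. The sparsified matrix \<open>P\<^sub>\<rho>\<close> is still row-stochastic, so \<open>H\<^sub>\<rho>\<close> is positive
  semidefinite, bounded, and annihilates constants. Hence the regularized direction \<open>d\<close> stays in the
  slice and satisfies \<open>- g \<bullet> d \<ge> \<parallel>g\<parallel> \<parallel>d\<parallel>\<^sup>2\<close> and \<open>\<parallel>g\<parallel> \<le> const \<parallel>d\<parallel>\<close>, the Armijo step is at least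
  \<open>const \<parallel>g\<parallel>\<close>, and each step decreases \<open>L\<close> by at least \<open>const \<parallel>g\<parallel>\<^sup>4\<close>. As \<open>L\<close> is coercive on the
  slice, \<open>g \<rightarrow> 0\<close>, and by convexity every cluster point is the unique minimizer.
\<close>

section \<open>Subsequence criterion for convergence\<close>

lemma bounded_seq_tendsto:
  fixes f :: "nat \<Rightarrow> 'a::heine_borel"
  assumes bdd: "bounded (range f)"
    and uniq: "\<And>r l. strict_mono r \<Longrightarrow> (f \<circ> r) \<longlonglongrightarrow> l \<Longrightarrow> l = x"
  shows "f \<longlonglongrightarrow> x"
proof (rule ccontr)
  assume "\<not> f \<longlonglongrightarrow> x"
  then obtain e where e: "e > 0" "\<not> (\<forall>\<^sub>F n in sequentially. dist (f n) x < e)"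
    unfolding tendsto_iff by blast
  define A where "A = {n. \<not> dist (f n) x < e}"
  have "infinite A"
    using e(2) unfolding A_def by (simp add: cofinite_eq_sequentially[symmetric] eventually_cofinite)
  \<comment> \<open>Listing \<open>A\<close> in increasing order gives a subsequence that stays at
    distance at least \<open>e\<close> from \<open>x\<close>; compactness then produces a limit that
    cannot be \<open>x\<close>.\<close>
  define r where "r = enumerate A"
  have r: "strict_mono r" "\<And>n. r n \<in> A"
    unfolding r_def using \<open>infinite A\<close> by (auto simp: strict_mono_enumerate enumerate_in_set)
  have "bounded (range (f \<circ> r))"
    using bdd by (rule bounded_subset) auto
  then obtain l s where s: "strict_mono s" "((f \<circ> r) \<circ> s) \<longlonglongrightarrow> l"
    using bounded_imp_convergent_subsequence by blast
  then have "l = x"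
    using uniq[of "r \<circ> s" l] r by (simp add: comp_assoc strict_mono_o)
  with s have "\<forall>\<^sub>F n in sequentially. dist ((f \<circ> r \<circ> s) n) x < e"
    using e(1) by (auto simp: tendsto_iff)
  then obtain n where "dist ((f \<circ> r \<circ> s) n) x < e"
    by (auto simp: eventually_sequentially)
  with r(2)[of "s n"] show False by (simp add: A_def)
qed

section \<open>Scalar estimates for the exponential\<close>

text \<open>The second-order Taylor remainder has coefficient \<open>exp t / 2\<close> with
  \<open>t\<close> at most 1, hence at most 3/2; the factor 2 is a rounded bound.\<close>

lemma exp_le_quadratic:
  fixes u :: real
  assumes "\<bar>u\<bar> \<le> 1"
  shows "exp u \<le> 1 + u + 2 * u\<^sup>2"
proof -
  obtain t where t: "\<bar>t\<bar> \<le> \<bar>u\<bar>" "exp u = (\<Sum>m<2. u ^ m / fact m) + exp t / fact 2 * u ^ 2"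
    using Maclaurin_exp_le[of u 2] by blast
  have "exp t \<le> exp 1" using t assms by simp
  also have "\<dots> \<le> 3" by (rule exp_le)
  finally have "exp t / 2 * u\<^sup>2 \<le> 2 * u\<^sup>2" by (intro mult_right_mono) auto
  then show ?thesis using t(2) by (simp add: numeral_2_eq_2)
qed

text \<open>Squaring the weak inequality at \<open>u / 2\<close> gains the term
  \<open>u\<^sup>2 / 4\<close>, which rules out equality unless \<open>u = 0\<close>. Equality would
  also give \<open>1 + u > 0\<close>, so the base being squared is nonnegative.\<close>

lemma exp_gt_one_plus:
  fixes u :: real
  assumes "u \<noteq> 0"
  shows "1 + u < exp u"
proof (rule ccontr)
  assume "\<not> 1 + u < exp u"
  then have eq: "exp u = 1 + u" using exp_ge_add_one_self[of u] by linarith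
  have "(1 + u / 2)\<^sup>2 \<le> (exp (u / 2))\<^sup>2" if "1 + u / 2 \<ge> 0"
    using that exp_ge_add_one_self[of "u / 2"] by (intro power_mono) auto
  moreover have "(exp (u / 2))\<^sup>2 = exp u" by (simp add: exp_double[symmetric])
  moreover have "1 + u > 0" using eq exp_gt_zero[of u] by linarith
  ultimately have "(1 + u / 2)\<^sup>2 \<le> 1 + u" using eq by simp
  then have "u\<^sup>2 \<le> 0" by (simp add: power2_eq_square algebra_simps)
  with assms show False by simp
qed

section \<open>Averages under a probability vector\<close>

lemma mean_add_const:
  fixes p u :: "'k::finite \<Rightarrow> real"
  assumes "(\<Sum>j\<in>UNIV. p j) = 1"
  shows "(\<Sum>j\<in>UNIV. p j * (u j + c)) = (\<Sum>j\<in>UNIV. p j * u j) + c"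
  by (simp add: distrib_left sum.distrib assms flip: sum_distrib_right)

lemma ex_max_component: "\<exists>k. \<forall>j. (x::real^'n) $ j \<le> x $ k"
proof -
  have "Max (range (($) x)) \<in> range (($) x)" by (rule Max_in) auto
  then obtain k where "Max (range (($) x)) = x $ k" by (rule imageE)
  then show ?thesis by (metis Max_ge finite_imageI finite_class.finite_UNIV rangeI)
qed

text \<open>Strict Jensen inequality. After centering at the mean \<open>c\<close>, the tangent
  bound for \<open>exp\<close> averages to 1, and it is strict at some index because two different
  values cannot both equal \<open>c\<close>.\<close>

lemma ln_mean_exp_gt:
  fixes p u :: "'k::finite \<Rightarrow> real"
  assumes p: "\<And>j. p j > 0" "(\<Sum>j\<in>UNIV. p j) = 1" and ne: "u r \<noteq> u s"
  shows "(\<Sum>j\<in>UNIV. p j * u j) < ln (\<Sum>j\<in>UNIV. p j * exp (u j))"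
proof -
  define c where "c = (\<Sum>j\<in>UNIV. p j * u j)"
  have "u r - c \<noteq> 0 \<or> u s - c \<noteq> 0" using ne by auto
  then obtain j0 where j0: "u j0 - c \<noteq> 0" by blast
  have "1 = (\<Sum>j\<in>UNIV. p j * (u j + (1 - c)))"
    using mean_add_const[OF p(2), of u "1 - c"] unfolding c_def[symmetric] by simp
  also have "\<dots> = (\<Sum>j\<in>UNIV. p j * (1 + (u j - c)))"
    by (simp add: algebra_simps)
  also have "\<dots> < (\<Sum>j\<in>UNIV. p j * exp (u j - c))"
  proof (rule sum_strict_mono_ex1)
    show "\<forall>j\<in>UNIV. p j * (1 + (u j - c)) \<le> p j * exp (u j - c)"
      by (intro ballI mult_left_mono less_imp_le[OF p(1)] exp_ge_add_one_self)
    show "\<exists>j\<in>UNIV. p j * (1 + (u j - c)) < p j * exp (u j - c)"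
      using exp_gt_one_plus[OF j0] p(1) by (intro bexI[of _ j0]) auto
  qed simp
  also have "\<dots> = (\<Sum>j\<in>UNIV. p j * exp (u j)) / exp c"
    by (simp add: exp_diff sum_divide_distrib)
  finally have *: "exp c < (\<Sum>j\<in>UNIV. p j * exp (u j))" by (simp add: field_simps)
  then have "0 < (\<Sum>j\<in>UNIV. p j * exp (u j))" using exp_gt_zero[of c] by linarith
  with * show ?thesis unfolding c_def[symmetric] by (metis exp_less_cancel_iff exp_ln)
qed

text \<open>Average the quadratic bound on \<open>exp\<close>, then apply
  \<open>ln y \<le> y - 1\<close>.\<close>

lemma ln_mean_exp_le:
  fixes p u :: "'k::finite \<Rightarrow> real"
  assumes p: "\<And>j. p j > 0" "(\<Sum>j\<in>UNIV. p j) = 1" and u: "\<And>j. \<bar>u j\<bar> \<le> 1"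
  shows "ln (\<Sum>j\<in>UNIV. p j * exp (u j)) \<le> (\<Sum>j\<in>UNIV. p j * u j) + 2 * (\<Sum>j\<in>UNIV. p j * (u j)\<^sup>2)"
proof -
  have "(\<Sum>j\<in>UNIV. p j * exp (u j)) \<le> (\<Sum>j\<in>UNIV. p j * (1 + u j + 2 * (u j)\<^sup>2))"
    by (intro sum_mono mult_left_mono exp_le_quadratic u less_imp_le[OF p(1)])
  also have "\<dots> = (\<Sum>j\<in>UNIV. p j * (u j + 2 * (u j)\<^sup>2 + 1))"
    by (simp add: add_ac)
  also have "\<dots> = (\<Sum>j\<in>UNIV. p j * u j + 2 * (p j * (u j)\<^sup>2)) + 1"
    by (simp add: mean_add_const[OF p(2)]) (simp add: distrib_left mult.left_commute)
  also have "\<dots> = 1 + ((\<Sum>j\<in>UNIV. p j * u j) + 2 * (\<Sum>j\<in>UNIV. p j * (u j)\<^sup>2))"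
    by (simp add: sum.distrib sum_distrib_left)
  finally have le: "(\<Sum>j\<in>UNIV. p j * exp (u j)) \<le> \<dots>" .
  have "0 < (\<Sum>j\<in>UNIV. p j * exp (u j))"
    using p(1) by (intro sum_pos) auto
  with le show ?thesis
    using ln_le_minus_one[of "\<Sum>j\<in>UNIV. p j * exp (u j)"] by linarith
qed

text \<open>A variance is nonnegative: expand the average of \<open>(h j - c)\<^sup>2\<close> around
  the mean \<open>c\<close>.\<close>

lemma mean_squared_le:
  fixes q h :: "'k::finite \<Rightarrow> real"
  assumes "\<And>j. q j \<ge> 0" "(\<Sum>j\<in>UNIV. q j) = 1"
  shows "(\<Sum>j\<in>UNIV. q j * h j)\<^sup>2 \<le> (\<Sum>j\<in>UNIV. q j * (h j)\<^sup>2)"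
proof -
  define c where "c = (\<Sum>j\<in>UNIV. q j * h j)"
  have "0 \<le> (\<Sum>j\<in>UNIV. q j * (h j - c)\<^sup>2)"
    using assms(1) by (intro sum_nonneg) auto
  also have "\<dots> = (\<Sum>j\<in>UNIV. q j * (h j)\<^sup>2 - 2 * c * (q j * h j) + c\<^sup>2 * q j)"
    by (intro sum.cong) (auto simp: power2_eq_square algebra_simps)
  also have "\<dots> = (\<Sum>j\<in>UNIV. q j * (h j)\<^sup>2) - 2 * c * c + c\<^sup>2"
    by (simp add: sum.distrib sum_subtractf assms(2) c_def flip: sum_distrib_left)
  finally show ?thesis by (simp add: c_def power2_eq_square)
qed

lemma abs_mean_le:
  fixes q h :: "'k::finite \<Rightarrow> real"
  assumes "\<And>j. q j \<ge> 0" "(\<Sum>j\<in>UNIV. q j) = 1" "\<And>j. \<bar>h j\<bar> \<le> B"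
  shows "\<bar>\<Sum>j\<in>UNIV. q j * h j\<bar> \<le> B"
proof -
  have "\<bar>\<Sum>j\<in>UNIV. q j * h j\<bar> \<le> (\<Sum>j\<in>UNIV. \<bar>q j * h j\<bar>)" by (rule sum_abs)
  also have "\<dots> \<le> (\<Sum>j\<in>UNIV. q j * B)"
    using assms by (intro sum_mono) (simp add: abs_mult mult_left_mono)
  finally show ?thesis using assms(2) by (simp flip: sum_distrib_right)
qed

section \<open>The bilinear form of the sparsified Hessian\<close>

text \<open>For row-stochastic \<open>Q\<close> this is the \<open>a\<close>-average, over the rows,
  of the covariance of \<open>h\<close> and \<open>k\<close> when the column index is distributed
  according to that row.\<close>

definition covariance_form :: "real^'m \<Rightarrow> real^'n^'m \<Rightarrow> real^'n \<Rightarrow> real^'n \<Rightarrow> real" where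
  "covariance_form a Q h k =
     (\<Sum>i\<in>UNIV. a $ i * ((\<Sum>j\<in>UNIV. Q $ i $ j * (h $ j * k $ j))
        - (\<Sum>j\<in>UNIV. Q $ i $ j * h $ j) * (\<Sum>j\<in>UNIV. Q $ i $ j * k $ j)))"

text \<open>This turns questions about the Hessian matrix into questions about row covariances:
  semidefiniteness, size and kernel are then read off from averages.\<close>

lemma inner_covariance_matrix:
  fixes Q :: "real^'n^'m"
  shows "h \<bullet> ((diag_mat (transpose Q *v a) - transpose Q ** diag_mat a ** Q) *v k)
     = covariance_form a Q h k"
proof -
  have diag: "diag_mat w *v x = (\<chi> i. w $ i * x $ i)" for w x :: "real^'k"
    by (simp add: vec_eq_iff diag_mat_def matrix_vector_mult_def if_distrib[of "\<lambda>y. y * _"] cong: if_cong)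
  have "h \<bullet> ((transpose Q ** diag_mat a ** Q) *v k) = (Q *v h) \<bullet> (diag_mat a *v (Q *v k))"
    by (simp add: matrix_vector_mul_assoc[symmetric] dot_lmul_matrix[symmetric]
        matrix_transpose_mul transpose_matrix_vector[symmetric] del: transpose_matrix_vector)
  also have "\<dots> = (\<Sum>i\<in>UNIV. a $ i * ((\<Sum>j\<in>UNIV. Q $ i $ j * h $ j) * (\<Sum>j\<in>UNIV. Q $ i $ j * k $ j)))"
    by (simp only: diag inner_vec_def) (simp add: matrix_vector_mult_def mult_ac)
  finally have 1: "h \<bullet> ((transpose Q ** diag_mat a ** Q) *v k) = \<dots>" .
  have "h \<bullet> (diag_mat (transpose Q *v a) *v k) = (\<Sum>j\<in>UNIV. \<Sum>i\<in>UNIV. a $ i * (Q $ i $ j * (h $ j * k $ j)))"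
    by (simp only: diag inner_vec_def) (simp add: vector_matrix_mult_def
        sum_distrib_left sum_distrib_right mult_ac)
  also have "\<dots> = (\<Sum>i\<in>UNIV. a $ i * (\<Sum>j\<in>UNIV. Q $ i $ j * (h $ j * k $ j)))"
    by (subst sum.swap) (simp add: sum_distrib_left)
  finally show ?thesis
    using 1 by (simp add: covariance_form_def matrix_vector_mult_diff_rdistrib inner_diff_right
        right_diff_distrib sum_subtractf)
qed

lemma covariance_form_nonneg:
  assumes "\<And>i. a $ i \<ge> 0" "\<And>i j. Q $ i $ j \<ge> 0" "\<And>i. (\<Sum>j\<in>UNIV. Q $ i $ j) = 1"
  shows "covariance_form a Q h h \<ge> 0"
  unfolding covariance_form_def
  using mean_squared_le[of "\<lambda>j. Q $ _ $ j" "\<lambda>j. h $ j"] assms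
  by (intro sum_nonneg mult_nonneg_nonneg) (auto simp: power2_eq_square)

text \<open>Components are bounded by norms, so in each row the mean of the product and the product
  of the means are both at most \<open>norm h * norm k\<close>; this gives the factor 2.\<close>

lemma abs_covariance_form_le:
  fixes Q :: "real^'n^'m"
  assumes "\<And>i. a $ i \<ge> 0" "(\<Sum>i\<in>UNIV. a $ i) = 1"
    and "\<And>i j. Q $ i $ j \<ge> 0" "\<And>i. (\<Sum>j\<in>UNIV. Q $ i $ j) = 1"
  shows "\<bar>covariance_form a Q h k\<bar> \<le> 2 * (norm h * norm k)"
  unfolding covariance_form_def
proof (rule abs_mean_le)
  fix i
  have "\<bar>\<Sum>j\<in>UNIV. Q $ i $ j * (h $ j * k $ j)\<bar> \<le> norm h * norm k"
    using assms by (intro abs_mean_le) (auto simp: abs_mult component_le_norm_cart intro!: mult_mono)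
  moreover have "\<bar>\<Sum>j\<in>UNIV. Q $ i $ j * x $ j\<bar> \<le> norm x" for x
    using assms by (intro abs_mean_le) (auto simp: component_le_norm_cart)
  then have "\<bar>(\<Sum>j\<in>UNIV. Q $ i $ j * h $ j) * (\<Sum>j\<in>UNIV. Q $ i $ j * k $ j)\<bar> \<le> norm h * norm k"
    unfolding abs_mult by (intro mult_mono) auto
  ultimately show "\<bar>(\<Sum>j\<in>UNIV. Q $ i $ j * (h $ j * k $ j))
      - (\<Sum>j\<in>UNIV. Q $ i $ j * h $ j) * (\<Sum>j\<in>UNIV. Q $ i $ j * k $ j)\<bar> \<le> 2 * (norm h * norm k)"
    by linarith
qed (use assms in auto)

lemma covariance_form_one_left:
  assumes "\<And>i. (\<Sum>j\<in>UNIV. Q $ i $ j) = 1"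
  shows "covariance_form a Q 1 k = 0"
  by (simp add: covariance_form_def assms)

lemma sum_center: "(\<Sum>j\<in>UNIV. center x $ j) = 0"
  by (simp add: center_def sum_subtractf)

section \<open>Armijo backtracking\<close>

text \<open>Either the full step is taken, or the preceding trial \<open>t / \<beta>\<close> was
  rejected and therefore lies beyond the threshold \<open>\<tau>\<close>.\<close>

lemma armijo_step_lower_bound:
  assumes step: "armijo_step \<sigma> \<beta> f x g d t"
    and \<beta>: "0 < \<beta>" "\<beta> < 1"
    and acc: "\<And>s. 0 \<le> s \<Longrightarrow> s \<le> \<tau> \<Longrightarrow> f (x + s *\<^sub>R d) \<le> f x + \<sigma> * s * (g \<bullet> d)"
  shows "min 1 (\<beta> * \<tau>) \<le> t" and "f (x + t *\<^sub>R d) \<le> f x + \<sigma> * t * (g \<bullet> d)"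
proof -
  let ?ok = "\<lambda>s. f (x + s *\<^sub>R d) \<le> f x + \<sigma> * s * (g \<bullet> d)"
  obtain l where l: "t = \<beta> ^ l"
    and ok: "?ok t" and max: "\<And>l'. ?ok (\<beta> ^ l') \<Longrightarrow> \<not> t < \<beta> ^ l'"
    using step unfolding armijo_step_def is_arg_max_def by auto
  show "?ok t" by (fact ok)
  show "min 1 (\<beta> * \<tau>) \<le> t"
  proof (cases l)
    case 0
    then show ?thesis using l by simp
  next
    case (Suc l')
    have "t < \<beta> ^ l'" using l Suc \<beta> by simp
    then have "\<not> \<beta> ^ l' \<le> \<tau>" using max acc[of "\<beta> ^ l'"] \<beta> by auto
    then have "\<beta> * \<tau> \<le> \<beta> * \<beta> ^ l'" using \<beta> by (intro mult_left_mono) auto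
    then show ?thesis using l Suc by simp
  qed
qed

section \<open>The dual function: increment, convexity, smoothness\<close>

locale ibsn =
  fixes C X :: "real^'n^'m" and a :: "real^'m" and b :: "real^'n" and \<eta> :: real
  assumes a_pos: "\<And>i. a $ i > 0" and a_sum: "(\<Sum>i\<in>UNIV. a $ i) = 1"
    and b_pos: "\<And>j. b $ j > 0" and b_sum: "(\<Sum>j\<in>UNIV. b $ j) = 1"
    and \<eta>_pos: "\<eta> > 0" and X_pos: "\<And>i j. X $ i $ j > 0"
begin

abbreviation "L \<equiv> ibsn_L C a b \<eta> X"
abbreviation "P \<equiv> ibsn_P C \<eta> X"
abbreviation "g \<equiv> ibsn_g C a b \<eta> X"
abbreviation "\<rho> \<equiv> ibsn_rho C a b \<eta> X"

lemma row_mass_pos: "(\<Sum>l\<in>UNIV. X $ i $ l * exp ((\<gamma> $ l - C $ i $ l) / \<eta>)) > 0"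
  by (intro sum_pos) (auto simp: X_pos)

lemma P_pos: "P \<gamma> $ i $ j > 0"
  by (simp add: ibsn_P_def X_pos row_mass_pos)

lemma P_row_sum: "(\<Sum>j\<in>UNIV. P \<gamma> $ i $ j) = 1"
  using row_mass_pos[where i = i and \<gamma> = \<gamma>] by (simp add: ibsn_P_def flip: sum_divide_distrib)

lemma inner_g:
  "g \<gamma> \<bullet> h = (\<Sum>i\<in>UNIV. a $ i * (\<Sum>j\<in>UNIV. P \<gamma> $ i $ j * h $ j)) - b \<bullet> h"
proof -
  have "(transpose (P \<gamma>) *v a) \<bullet> h = a \<bullet> (P \<gamma> *v h)"
    by (simp add: dot_lmul_matrix)
  then show ?thesis
    by (simp add: ibsn_g_eq \<eta>_pos X_pos inner_diff_left) (simp add: inner_vec_def matrix_vector_mult_def)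
qed

text \<open>A shift by \<open>h\<close> multiplies the mass of each row by the
  \<open>P \<gamma>\<close>-average of \<open>exp (h $ j / \<eta>)\<close>, and the logarithm splits
  the product.\<close>

lemma L_add:
  "L (\<gamma> + h) = L \<gamma> - b \<bullet> h + \<eta> * (\<Sum>i\<in>UNIV. a $ i * ln (\<Sum>j\<in>UNIV. P \<gamma> $ i $ j * exp (h $ j / \<eta>)))"
proof -
  define S where "S i = (\<Sum>l\<in>UNIV. X $ i $ l * exp ((\<gamma> $ l - C $ i $ l) / \<eta>))" for i
  have S: "S i > 0" for i by (simp add: S_def row_mass_pos)
  have split: "(\<Sum>j\<in>UNIV. X $ i $ j * exp (((\<gamma> + h) $ j - C $ i $ j) / \<eta>))
      = S i * (\<Sum>j\<in>UNIV. P \<gamma> $ i $ j * exp (h $ j / \<eta>))" for i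
  proof -
    have "X $ i $ j * exp (((\<gamma> + h) $ j - C $ i $ j) / \<eta>)
        = S i * (P \<gamma> $ i $ j * exp (h $ j / \<eta>))" for j
    proof -
      have "((\<gamma> + h) $ j - C $ i $ j) / \<eta> = (\<gamma> $ j - C $ i $ j) / \<eta> + h $ j / \<eta>"
        by (simp add: add_divide_distrib diff_divide_distrib)
      then show ?thesis using S[of i]
        by (simp add: ibsn_P_def S_def[symmetric] exp_add)
    qed
    then show ?thesis by (simp add: sum_distrib_left)
  qed
  have pos: "(\<Sum>j\<in>UNIV. P \<gamma> $ i $ j * exp (h $ j / \<eta>)) > 0" for i
    by (intro sum_pos) (auto simp: P_pos)
  show ?thesis
    unfolding ibsn_L_def split using S pos
    by (simp add: S_def[symmetric] ln_mult less_imp_neq[THEN not_sym] ring_distribs sum.distrib inner_vec_def mult.commute)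
qed

text \<open>Strict Jensen in every row, averaged with the positive weights \<open>a\<close>.
  Non-constancy of \<open>h\<close> is the right condition, since \<open>L\<close> does not change
  along constant vectors.\<close>

lemma L_strict_convex:
  assumes "h $ r \<noteq> h $ s"
  shows "L \<gamma> + g \<gamma> \<bullet> h < L (\<gamma> + h)"
proof -
  have "(\<Sum>j\<in>UNIV. P \<gamma> $ i $ j * (h $ j / \<eta>)) < ln (\<Sum>j\<in>UNIV. P \<gamma> $ i $ j * exp (h $ j / \<eta>))" for i
    using assms \<eta>_pos by (intro ln_mean_exp_gt[where r = r and s = s] P_pos P_row_sum) auto
  then have "(\<Sum>i\<in>UNIV. a $ i * (\<Sum>j\<in>UNIV. P \<gamma> $ i $ j * (h $ j / \<eta>)))
      < (\<Sum>i\<in>UNIV. a $ i * ln (\<Sum>j\<in>UNIV. P \<gamma> $ i $ j * exp (h $ j / \<eta>)))"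
    using a_pos by (intro sum_strict_mono) auto
  then show ?thesis
    unfolding L_add inner_g using \<eta>_pos by (simp add: field_simps flip: sum_divide_distrib)
qed

text \<open>The restriction on \<open>h\<close> puts all \<open>h $ j / \<eta>\<close> in [-1, 1],
  where the quadratic bound on the log-mean-exp holds; scaling its error by \<open>\<eta>\<close>
  leaves \<open>2 / \<eta>\<close>.\<close>

lemma L_quadratic_upper_bound:
  assumes "norm h \<le> \<eta>"
  shows "L (\<gamma> + h) \<le> L \<gamma> + g \<gamma> \<bullet> h + 2 / \<eta> * (norm h)\<^sup>2"
proof -
  have h: "\<bar>h $ j / \<eta>\<bar> \<le> norm h / \<eta>" for j
    using \<eta>_pos component_le_norm_cart[of h j] by (simp add: abs_divide divide_right_mono)
  have h1: "\<bar>h $ j / \<eta>\<bar> \<le> 1" for j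
    using h[of j] assms \<eta>_pos by (simp add: field_simps)
  have "ln (\<Sum>j\<in>UNIV. P \<gamma> $ i $ j * exp (h $ j / \<eta>))
      \<le> (\<Sum>j\<in>UNIV. P \<gamma> $ i $ j * (h $ j / \<eta>)) + 2 * (norm h / \<eta>)\<^sup>2" for i
  proof -
    have "\<bar>(h $ j / \<eta>)\<^sup>2\<bar> \<le> (norm h / \<eta>)\<^sup>2" for j
      using power_mono[OF h[of j], of 2] by (simp only: power2_abs abs_power2 abs_ge_zero)
    then have "\<bar>\<Sum>j\<in>UNIV. P \<gamma> $ i $ j * (h $ j / \<eta>)\<^sup>2\<bar> \<le> (norm h / \<eta>)\<^sup>2"
      by (intro abs_mean_le less_imp_le[OF P_pos] P_row_sum)
    then show ?thesis
      using ln_mean_exp_le[of "\<lambda>j. P \<gamma> $ i $ j" "\<lambda>j. h $ j / \<eta>", OF P_pos P_row_sum h1] by linarith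
  qed
  then have "(\<Sum>i\<in>UNIV. a $ i * ln (\<Sum>j\<in>UNIV. P \<gamma> $ i $ j * exp (h $ j / \<eta>)))
      \<le> (\<Sum>i\<in>UNIV. a $ i * ((\<Sum>j\<in>UNIV. P \<gamma> $ i $ j * (h $ j / \<eta>)) + 2 * (norm h / \<eta>)\<^sup>2))"
    by (intro sum_mono mult_left_mono less_imp_le[OF a_pos])
  also have "\<dots> = (\<Sum>i\<in>UNIV. a $ i * (\<Sum>j\<in>UNIV. P \<gamma> $ i $ j * h $ j)) / \<eta> + 2 * (norm h / \<eta>)\<^sup>2"
    by (simp add: mean_add_const[OF a_sum] sum_divide_distrib[symmetric])
  finally have "\<eta> * (\<Sum>i\<in>UNIV. a $ i * ln (\<Sum>j\<in>UNIV. P \<gamma> $ i $ j * exp (h $ j / \<eta>))) \<le> \<eta> * \<dots>"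
    using \<eta>_pos by (intro mult_left_mono) auto
  also have "\<dots> = (\<Sum>i\<in>UNIV. a $ i * (\<Sum>j\<in>UNIV. P \<gamma> $ i $ j * h $ j)) + 2 / \<eta> * (norm h)\<^sup>2"
    using \<eta>_pos by (simp add: field_simps power2_eq_square)
  finally show ?thesis unfolding L_add inner_g by linarith
qed

lemma inner_g_one: "g \<gamma> \<bullet> 1 = 0"
  unfolding inner_g by (simp add: P_row_sum a_sum inner_vec_def b_sum)

text \<open>Test the gradient against itself: \<open>g \<gamma> \<bullet> g \<gamma>\<close> is a
  difference of two averages of components of \<open>g \<gamma>\<close>, each at most its norm in
  absolute value.\<close>

lemma norm_g_le: "norm (g \<gamma>) \<le> 2"
proof -
  have "\<bar>\<Sum>i\<in>UNIV. a $ i * (\<Sum>j\<in>UNIV. P \<gamma> $ i $ j * g \<gamma> $ j)\<bar> \<le> norm (g \<gamma>)"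
    by (intro abs_mean_le less_imp_le[OF a_pos] a_sum less_imp_le[OF P_pos] P_row_sum
        component_le_norm_cart)
  moreover have "\<bar>\<Sum>j\<in>UNIV. b $ j * g \<gamma> $ j\<bar> \<le> norm (g \<gamma>)"
    by (intro abs_mean_le less_imp_le[OF b_pos] b_sum component_le_norm_cart)
  ultimately have "g \<gamma> \<bullet> g \<gamma> \<le> 2 * norm (g \<gamma>)"
    unfolding inner_g[of \<gamma> "g \<gamma>"] by (simp add: inner_vec_def)
  then have "norm (g \<gamma>) * norm (g \<gamma>) \<le> 2 * norm (g \<gamma>)"
    by (simp add: dot_square_norm power2_eq_square)
  then show ?thesis
    using mult_right_le_imp_le[of "norm (g \<gamma>)" "norm (g \<gamma>)" 2] by (cases "g \<gamma> = 0") auto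
qed

section \<open>Coercivity on the slice\<close>

text \<open>Keep only the \<open>k\<close>-th term of each logarithm's argument. The linear parts
  then combine to \<open>x $ k\<close> minus the \<open>b\<close>-mean of \<open>x\<close>; the
  maximum over \<open>k\<close> makes \<open>K\<close> uniform.\<close>

lemma L_coercive:
  obtains K where "\<And>x k. (\<Sum>j\<in>UNIV. b $ j * (x $ k - x $ j)) - K \<le> L x"
proof -
  define K where "K = Max ((\<lambda>k. - (\<Sum>i\<in>UNIV. a $ i * (\<eta> * ln (X $ i $ k) - C $ i $ k))) ` UNIV)"
  have "(\<Sum>j\<in>UNIV. b $ j * (x $ k - x $ j)) - K \<le> L x" for x k
  proof -
    have "\<eta> * ln (X $ i $ k) + (x $ k - C $ i $ k)
        \<le> \<eta> * ln (\<Sum>j\<in>UNIV. X $ i $ j * exp ((x $ j - C $ i $ j) / \<eta>))" for i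
    proof -
      have "X $ i $ k * exp ((x $ k - C $ i $ k) / \<eta>)
          \<le> (\<Sum>j\<in>UNIV. X $ i $ j * exp ((x $ j - C $ i $ j) / \<eta>))"
        by (rule member_le_sum) (auto simp: X_pos less_imp_le)
      then have "ln (X $ i $ k * exp ((x $ k - C $ i $ k) / \<eta>))
          \<le> ln (\<Sum>j\<in>UNIV. X $ i $ j * exp ((x $ j - C $ i $ j) / \<eta>))"
        using X_pos by (intro ln_mono) auto
      moreover have "ln (X $ i $ k * exp ((x $ k - C $ i $ k) / \<eta>)) = ln (X $ i $ k) + (x $ k - C $ i $ k) / \<eta>"
        using X_pos[of i k] by (subst ln_mult) auto
      ultimately have "\<eta> * (ln (X $ i $ k) + (x $ k - C $ i $ k) / \<eta>)
          \<le> \<eta> * ln (\<Sum>j\<in>UNIV. X $ i $ j * exp ((x $ j - C $ i $ j) / \<eta>))"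
        using \<eta>_pos by (intro mult_left_mono) auto
      moreover have "\<eta> * ((x $ k - C $ i $ k) / \<eta>) = x $ k - C $ i $ k" using \<eta>_pos by simp
      ultimately show ?thesis by (simp only: distrib_left)
    qed
    then have "(\<Sum>i\<in>UNIV. a $ i * (\<eta> * ln (X $ i $ k) + (x $ k - C $ i $ k)))
        \<le> (\<Sum>i\<in>UNIV. a $ i * (\<eta> * ln (\<Sum>j\<in>UNIV. X $ i $ j * exp ((x $ j - C $ i $ j) / \<eta>))))"
      by (intro sum_mono mult_left_mono less_imp_le[OF a_pos])
    also have "\<dots> = L x + (\<Sum>j\<in>UNIV. b $ j * x $ j)"
      by (simp add: ibsn_L_def sum_distrib_left mult_ac)
    also have "(\<Sum>i\<in>UNIV. a $ i * (\<eta> * ln (X $ i $ k) + (x $ k - C $ i $ k)))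
        = x $ k + (\<Sum>i\<in>UNIV. a $ i * (\<eta> * ln (X $ i $ k) - C $ i $ k))"
      using mean_add_const[OF a_sum, of "\<lambda>i. \<eta> * ln (X $ i $ k) - C $ i $ k" "x $ k"]
      by (simp add: algebra_simps)
    finally have "x $ k + (\<Sum>i\<in>UNIV. a $ i * (\<eta> * ln (X $ i $ k) - C $ i $ k)) \<le> L x + (\<Sum>j\<in>UNIV. b $ j * x $ j)" .
    moreover have "- (\<Sum>i\<in>UNIV. a $ i * (\<eta> * ln (X $ i $ k) - C $ i $ k)) \<le> K"
      unfolding K_def by (rule Max_ge) auto
    moreover have "(\<Sum>j\<in>UNIV. b $ j * (x $ k - x $ j)) = x $ k - (\<Sum>j\<in>UNIV. b $ j * x $ j)"
      using mean_add_const[OF b_sum, of "\<lambda>j. - x $ j" "x $ k"] by (simp add: sum_negf)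
    ultimately show ?thesis by linarith
  qed
  then show ?thesis using that by blast
qed

lemma L_bounded_below: "\<exists>B. \<forall>x. B \<le> L x"
proof -
  obtain K where K: "\<And>x k. (\<Sum>j\<in>UNIV. b $ j * (x $ k - x $ j)) - K \<le> L x"
    using L_coercive by blast
  have "- K \<le> L x" for x
  proof -
    obtain k where k: "\<And>j. x $ j \<le> x $ k" using ex_max_component by blast
    have "0 \<le> (\<Sum>j\<in>UNIV. b $ j * (x $ k - x $ j))"
      using k by (intro sum_nonneg mult_nonneg_nonneg less_imp_le[OF b_pos]) auto
    then show ?thesis using K[of x k] by linarith
  qed
  then show ?thesis by blast
qed

text \<open>For a maximal coordinate \<open>k\<close> all terms of the coercivity bound are
  nonnegative, so each gap \<open>x $ k - x $ j\<close> is controlled separately. The zero sum then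
  turns bounds on gaps into bounds on coordinates.\<close>

lemma bounded_sublevel_slice: "bounded {x. (\<Sum>j\<in>UNIV. x $ j) = 0 \<and> L x \<le> c}"
proof -
  obtain K where K: "\<And>x k. (\<Sum>j\<in>UNIV. b $ j * (x $ k - x $ j)) - K \<le> L x"
    using L_coercive by blast
  define R where "R = (\<Sum>j\<in>UNIV. (c + K) / b $ j)"
  have "norm x \<le> (\<Sum>j\<in>(UNIV::'n set). R)" if x: "(\<Sum>j\<in>UNIV. x $ j) = 0" "L x \<le> c" for x
  proof -
    obtain k where k: "\<And>j. x $ j \<le> x $ k" using ex_max_component by blast
    have gap: "b $ j * (x $ k - x $ j) \<le> c + K" for j
    proof -
      have "b $ j * (x $ k - x $ j) \<le> (\<Sum>j\<in>UNIV. b $ j * (x $ k - x $ j))"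
        by (rule member_le_sum) (auto simp: b_pos k less_imp_le)
      then show ?thesis using K[of x k] x(2) by linarith
    qed
    have cK: "0 \<le> c + K" using gap[of k] by simp
    have gap': "x $ k - x $ j \<le> R" for j
    proof -
      have "x $ k - x $ j \<le> (c + K) / b $ j" using gap[of j] b_pos[of j] by (simp add: field_simps)
      also have "\<dots> \<le> R" unfolding R_def
        by (rule member_le_sum) (use cK b_pos in \<open>auto simp: less_imp_le\<close>)
      finally show ?thesis .
    qed
    have "0 \<le> x $ k"
    proof (rule ccontr)
      assume "\<not> 0 \<le> x $ k"
      then have "x $ j < 0" for j using k[of j] by linarith
      then have "(\<Sum>j\<in>UNIV. x $ j) < (\<Sum>j\<in>(UNIV::'n set). 0)" by (intro sum_strict_mono) auto
      with x(1) show False by simp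
    qed
    moreover obtain l where "x $ l \<le> 0"
    proof (rule ccontr)
      assume "\<not> thesis"
      then have "0 < x $ j" for j using that by (meson not_le)
      then have "0 < (\<Sum>j\<in>UNIV. x $ j)" by (intro sum_pos) auto
      with x(1) show False by simp
    qed
    \<comment> \<open>The gap to the nonpositive coordinate \<open>l\<close> gives
      \<open>x $ k \<le> R\<close>; the gap to \<open>j\<close> and \<open>0 \<le> x $ k\<close>
      give \<open>- R \<le> x $ j\<close>.\<close>
    ultimately have "\<bar>x $ j\<bar> \<le> R" for j
      using k[of j] gap'[of j] gap'[of l] by linarith
    then have "(\<Sum>j\<in>UNIV. \<bar>x $ j\<bar>) \<le> (\<Sum>j\<in>(UNIV::'n set). R)" by (intro sum_mono)
    with norm_le_l1_cart[of x] show ?thesis by linarith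
  qed
  then show ?thesis unfolding bounded_iff by blast
qed

section \<open>Uniqueness of the slice minimizer\<close>

lemma L_strict_convex_slice:
  assumes "(\<Sum>j\<in>UNIV. x $ j) = 0" "(\<Sum>j\<in>UNIV. y $ j) = 0" "x \<noteq> y"
  shows "L x + g x \<bullet> (y - x) < L y"
proof -
  have "\<exists>r s. (y - x) $ r \<noteq> (y - x) $ s"
  proof (rule ccontr)
    assume "\<not> ?thesis"
    then obtain c where c: "\<And>j. (y - x) $ j = c" by metis
    then have "(\<Sum>j\<in>UNIV. (y - x) $ j) = real CARD('n) * c" by simp
    then have "c = 0" using assms by (simp add: sum_subtractf)
    with c assms(3) show False by (simp add: vec_eq_iff)
  qed
  then show ?thesis using L_strict_convex[of "y - x" _ _ x] by auto
qed

text \<open>Apply the strict tangent inequality at the midpoint \<open>z\<close> in the two opposite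
  directions: the linear terms cancel on addition, so \<open>x\<close> and \<open>y\<close> cannot
  both be as low as \<open>z\<close>.\<close>

lemma slice_minimizer_unique:
  assumes "is_arg_min L (\<lambda>x. (\<Sum>j\<in>UNIV. x $ j) = 0) x"
    and "is_arg_min L (\<lambda>x. (\<Sum>j\<in>UNIV. x $ j) = 0) y"
  shows "x = y"
proof (rule ccontr)
  assume "x \<noteq> y"
  define z where "z = (1 / 2) *\<^sub>R (x + y)"
  have s: "(\<Sum>j\<in>UNIV. x $ j) = 0" "(\<Sum>j\<in>UNIV. y $ j) = 0"
    using assms by (auto simp: is_arg_min_def)
  then have z: "(\<Sum>j\<in>UNIV. z $ j) = 0"
    by (simp add: z_def sum.distrib flip: sum_divide_distrib sum_distrib_left)
  have xz: "x - z = (1 / 2) *\<^sub>R (x - y)" "y - z = - (x - z)"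
    by (simp_all add: z_def vec_eq_iff field_simps)
  with \<open>x \<noteq> y\<close> have "z \<noteq> x" "z \<noteq> y" by auto
  then have "L z + g z \<bullet> (x - z) < L x" "L z + g z \<bullet> (y - z) < L y"
    using L_strict_convex_slice z s by auto
  moreover have "L x \<le> L z" "L y \<le> L z"
    using assms z by (auto simp: is_arg_min_linorder)
  ultimately show False unfolding xz(2) inner_minus_right by linarith
qed

lemma isCont_L: "isCont L x"
  using GDERIV_ibsn_L[OF \<eta>_pos X_pos] unfolding gderiv_def by (rule has_derivative_continuous)

section \<open>The sparsified Hessian and the regularized Newton direction\<close>

lemma sparsify_stochastic:
  assumes "\<forall>i. i \<noteq> istar \<longrightarrow> kept_mass r (P \<gamma>) i \<noteq> 0"
  shows "sparsify istar r (P \<gamma>) $ i $ j \<ge> 0" and "(\<Sum>j\<in>UNIV. sparsify istar r (P \<gamma>) $ i $ j) = 1"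
proof -
  have "kept_mass r (P \<gamma>) i \<ge> 0" for i
    unfolding kept_mass_def by (intro sum_nonneg) (auto simp: P_pos less_imp_le)
  then show "sparsify istar r (P \<gamma>) $ i $ j \<ge> 0"
    using P_pos[of \<gamma> i j] by (auto simp: sparsify_def less_imp_le)
  show "(\<Sum>j\<in>UNIV. sparsify istar r (P \<gamma>) $ i $ j) = 1"
  proof (cases "i = istar")
    case True
    then show ?thesis by (simp add: sparsify_def P_row_sum)
  next
    case False
    then have "(\<Sum>j\<in>UNIV. sparsify istar r (P \<gamma>) $ i $ j) = kept_mass r (P \<gamma>) i / kept_mass r (P \<gamma>) i"
      by (simp only: sparsify_def vec_lambda_beta if_False kept_mass_def flip: sum_divide_distrib)
    then show ?thesis using assms False by simp
  qed
qed

context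
  fixes istar :: 'm and \<gamma> :: "real^'n"
  assumes kept: "\<forall>i. i \<noteq> istar \<longrightarrow> kept_mass (\<rho> \<gamma>) (P \<gamma>) i \<noteq> 0"
begin

abbreviation "H \<equiv> ibsn_H C a \<eta> X istar (\<rho> \<gamma>) \<gamma>"
abbreviation "d \<equiv> ibsn_dir C a b \<eta> X istar \<gamma>"

lemma inner_H: "h \<bullet> (H *v k) = covariance_form a (sparsify istar (\<rho> \<gamma>) (P \<gamma>)) h k / \<eta>"
  unfolding ibsn_H_def Let_def
  by (simp only: scaleR_matrix_vector_assoc[symmetric] inner_scaleR_right inner_covariance_matrix) simp

lemma H_nonneg: "h \<bullet> (H *v h) \<ge> 0"
  unfolding inner_H using \<eta>_pos sparsify_stochastic[OF kept] a_pos
  by (simp add: covariance_form_nonneg less_imp_le)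

text \<open>Pair \<open>H *v k\<close> with itself, apply the covariance bound and cancel one factor
  \<open>norm (H *v k)\<close>.\<close>

lemma norm_H_le: "norm (H *v k) \<le> 2 / \<eta> * norm k"
proof -
  have "\<bar>covariance_form a (sparsify istar (\<rho> \<gamma>) (P \<gamma>)) (H *v k) k\<bar> \<le> 2 * (norm (H *v k) * norm k)"
    using sparsify_stochastic[OF kept] by (intro abs_covariance_form_le less_imp_le[OF a_pos] a_sum) auto
  then have "(H *v k) \<bullet> (H *v k) \<le> 2 * (norm (H *v k) * norm k) / \<eta>"
    unfolding inner_H using \<eta>_pos by (intro divide_right_mono) auto
  then have "norm (H *v k) * norm (H *v k) \<le> norm (H *v k) * (2 / \<eta> * norm k)"
    by (simp add: dot_square_norm power2_eq_square mult_ac)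
  then show ?thesis
    using \<eta>_pos mult_left_le_imp_le[of "norm (H *v k)" "norm (H *v k)" "2 / \<eta> * norm k"]
    by (cases "H *v k = 0") auto
qed

text \<open>For a nonzero gradient the regularized matrix is positive definite, so
  \<open>matrix_inv\<close> is a true inverse. For a zero gradient both sides vanish, which lets
  later arguments use one equation.\<close>

lemma dir_equation: "H *v d + norm (g \<gamma>) *\<^sub>R d = - g \<gamma>"
proof (cases "g \<gamma> = 0")
  case True
  then show ?thesis by (simp add: ibsn_dir_def)
next
  case False
  define M where "M = H + norm (g \<gamma>) *\<^sub>R mat 1"
  have Mv: "M *v x = H *v x + norm (g \<gamma>) *\<^sub>R x" for x
    by (simp add: M_def matrix_vector_mult_add_rdistrib scaleR_matrix_vector_assoc[symmetric])
  have "x = 0" if "M *v x = 0" for x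
  proof -
    have "x \<bullet> (H *v x) + norm (g \<gamma>) * (x \<bullet> x) = x \<bullet> (M *v x)"
      by (simp add: Mv inner_add_right)
    then have "norm (g \<gamma>) * (x \<bullet> x) \<le> 0" using H_nonneg[of x] that by simp
    then have "x \<bullet> x \<le> 0" using False by (simp add: mult_le_0_iff)
    then show ?thesis by (metis inner_gt_zero_iff not_le)
  qed
  then have "invertible M"
    using matrix_left_invertible_ker invertible_left_inverse by blast
  then have "M ** matrix_inv M = mat 1"
    unfolding invertible_def matrix_inv_def by (rule someI2_ex) blast
  then have "M *v (matrix_inv M *v g \<gamma>) = g \<gamma>"
    by (simp add: matrix_vector_mul_assoc)
  moreover have "d = - (matrix_inv M *v g \<gamma>)"
    using False by (simp add: ibsn_dir_def Let_def M_def)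
  ultimately have "M *v d = - g \<gamma>"
    using matrix_vector_mult_diff_distrib[of M 0 "matrix_inv M *v g \<gamma>"] by simp
  then show ?thesis by (simp add: Mv)
qed

text \<open>Pair the direction equation with the constant vector: the Hessian term and the gradient
  drop out, leaving \<open>norm (g \<gamma>) * (1 \<bullet> d) = 0\<close>.\<close>

lemma dir_slice: "(\<Sum>j\<in>UNIV. d $ j) = 0"
proof (cases "g \<gamma> = 0")
  case True
  then show ?thesis by (simp add: ibsn_dir_def)
next
  case False
  have "1 \<bullet> (H *v d) = 0"
    unfolding inner_H using sparsify_stochastic(2)[OF kept] by (simp add: covariance_form_one_left)
  moreover have "1 \<bullet> (H *v d + norm (g \<gamma>) *\<^sub>R d) = 0"
    unfolding dir_equation using inner_g_one[of \<gamma>] by (simp add: inner_commute)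
  ultimately have "1 \<bullet> d = 0" using False by (simp add: inner_add_right)
  then show ?thesis by (simp add: inner_vec_def)
qed

text \<open>Pair the direction equation with \<open>d\<close> and discard the nonnegative Hessian
  term.\<close>

lemma dir_descent: "norm (g \<gamma>) * (norm d)\<^sup>2 \<le> - (g \<gamma> \<bullet> d)"
proof -
  have "d \<bullet> (H *v d) + norm (g \<gamma>) * (d \<bullet> d) = - (g \<gamma> \<bullet> d)"
    using arg_cong[OF dir_equation, of "(\<bullet>) d"] by (simp add: inner_add_right inner_commute)
  then show ?thesis using H_nonneg[of d] by (simp add: dot_square_norm)
qed

lemma norm_dir_le: "norm d \<le> 1"
proof (cases "g \<gamma> = 0 \<or> d = 0")
  case True
  then show ?thesis by (auto simp: ibsn_dir_def)
next
  case False
  have "- (g \<gamma> \<bullet> d) \<le> norm (g \<gamma>) * norm d"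
    using norm_cauchy_schwarz[of "- g \<gamma>" d] by simp
  then have "(norm (g \<gamma>) * norm d) * norm d \<le> (norm (g \<gamma>) * norm d) * 1"
    using dir_descent by (simp add: power2_eq_square)
  then show ?thesis using False by simp
qed

lemma norm_g_le_dir: "norm (g \<gamma>) \<le> (2 / \<eta> + 2) * norm d"
proof -
  have "norm (g \<gamma>) = norm (H *v d + norm (g \<gamma>) *\<^sub>R d)"
    unfolding dir_equation by simp
  also have "\<dots> \<le> 2 / \<eta> * norm d + norm (g \<gamma>) * norm d"
    using norm_triangle_ineq[of "H *v d" "norm (g \<gamma>) *\<^sub>R d"] norm_H_le[of d] by simp
  also have "\<dots> \<le> 2 / \<eta> * norm d + 2 * norm d"
    using norm_g_le[of \<gamma>] by (simp add: mult_right_mono)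
  finally show ?thesis by (simp add: algebra_simps)
qed

text \<open>Below this threshold the quadratic error is at most half of the linear decrease, by
  \<open>dir_descent\<close>.\<close>

lemma armijo_acceptable:
  assumes \<sigma>: "\<sigma> \<le> 1 / 2" and s: "0 \<le> s" "s \<le> \<eta> * norm (g \<gamma>) / 4"
  shows "L (\<gamma> + s *\<^sub>R d) \<le> L \<gamma> + \<sigma> * s * (g \<gamma> \<bullet> d)"
proof -
  \<comment> \<open>Together with \<open>norm d \<le> 1\<close> this keeps the displacement in the
    region where the quadratic upper bound is valid.\<close>
  have "\<eta> * norm (g \<gamma>) / 4 \<le> \<eta>" using norm_g_le[of \<gamma>] \<eta>_pos by simp
  then have "norm (s *\<^sub>R d) \<le> \<eta>"
    using s norm_dir_le mult_left_mono[of "norm d" 1 s] by simp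
  then have "L (\<gamma> + s *\<^sub>R d) \<le> L \<gamma> + s * (g \<gamma> \<bullet> d) + 2 / \<eta> * (s * s) * (norm d)\<^sup>2"
    using L_quadratic_upper_bound[of "s *\<^sub>R d" \<gamma>] by (simp add: power2_eq_square mult_ac)
  also have "2 / \<eta> * (s * s) * (norm d)\<^sup>2 \<le> 2 / \<eta> * (s * (\<eta> * norm (g \<gamma>) / 4)) * (norm d)\<^sup>2"
    using s \<eta>_pos by (intro mult_right_mono mult_left_mono) auto
  also have "\<dots> = s / 2 * (norm (g \<gamma>) * (norm d)\<^sup>2)"
    using \<eta>_pos by simp
  also have "\<dots> \<le> s / 2 * (- (g \<gamma> \<bullet> d))"
    using s dir_descent by (intro mult_left_mono) auto
  finally have "L (\<gamma> + s *\<^sub>R d) \<le> L \<gamma> + s * (g \<gamma> \<bullet> d) / 2" by simp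
  also have "s * (g \<gamma> \<bullet> d) / 2 \<le> \<sigma> * s * (g \<gamma> \<bullet> d)"
  proof -
    have "0 \<le> norm (g \<gamma>) * (norm d)\<^sup>2" by simp
    then have "g \<gamma> \<bullet> d \<le> 0" using dir_descent by linarith
    then have "s * (g \<gamma> \<bullet> d) \<le> 0" using s by (simp add: mult_nonneg_nonpos)
    from mult_right_mono_neg[OF \<sigma> this] show ?thesis by (simp add: mult.assoc)
  qed
  finally show ?thesis by simp
qed

end

section \<open>Decrease per Newton step\<close>

text \<open>The factors are the Armijo parameter, the slope of a lower bound for the step length
  that is linear in \<open>norm (g \<gamma>)\<close>, and the squared constant of
  \<open>norm_g_le_dir\<close>.\<close>

definition decrease_const :: real where
  "decrease_const = 1 / 10 ^ 4 * min (1 / 2) (\<eta> / 5) / (2 / \<eta> + 2)\<^sup>2"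

lemma decrease_const_pos: "decrease_const > 0"
  unfolding decrease_const_def using \<eta>_pos by (intro divide_pos_pos mult_pos_pos zero_less_power add_pos_pos) auto

lemma newton_step_slice:
  assumes "\<forall>i. i \<noteq> istar \<longrightarrow> kept_mass (\<rho> \<gamma>) (P \<gamma>) i \<noteq> 0"
    and "newton_step C a b \<eta> X istar \<gamma> \<gamma>'" and "(\<Sum>j\<in>UNIV. \<gamma> $ j) = 0"
  shows "(\<Sum>j\<in>UNIV. \<gamma>' $ j) = 0"
  using assms(2,3) dir_slice[OF assms(1)]
  by (auto simp: newton_step_def sum.distrib simp flip: sum_distrib_left)

text \<open>One power of \<open>norm (g \<gamma>)\<close> comes from the step length, one from the
  regularization in \<open>dir_descent\<close>, and two from bounding \<open>norm d\<close>
  below.\<close>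

lemma newton_step_decrease:
  assumes kept: "\<forall>i. i \<noteq> istar \<longrightarrow> kept_mass (\<rho> \<gamma>) (P \<gamma>) i \<noteq> 0"
    and "newton_step C a b \<eta> X istar \<gamma> \<gamma>'"
  shows "L \<gamma>' + decrease_const * norm (g \<gamma>) ^ 4 \<le> L \<gamma>"
proof -
  let ?d = "ibsn_dir C a b \<eta> X istar \<gamma>" and ?N = "norm (g \<gamma>)"
  define k where "k = 2 / \<eta> + 2"
  have k: "k > 0" using \<eta>_pos by (simp add: k_def add_pos_pos)
  obtain t where step: "armijo_step (1 / 10 ^ 4) (4 / 5) L \<gamma> (g \<gamma>) ?d t"
    and \<gamma>': "\<gamma>' = \<gamma> + t *\<^sub>R ?d"
    using assms(2) unfolding newton_step_def by blast
  have t: "min 1 (4 / 5 * (\<eta> * ?N / 4)) \<le> t"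
    and dec: "L \<gamma>' \<le> L \<gamma> + 1 / 10 ^ 4 * t * (g \<gamma> \<bullet> ?d)"
    using armijo_step_lower_bound[OF step, of "\<eta> * ?N / 4"] armijo_acceptable[OF kept, of "1 / 10 ^ 4"]
    unfolding \<gamma>' by auto
  \<comment> \<open>Since \<open>?N \<le> 2\<close>, the slope 1/2 keeps the bound below the full
    step 1; the slope \<open>\<eta> / 5\<close> is the backtracking factor 4/5 times
    \<open>\<eta> / 4\<close>.\<close>
  have tN: "min (1 / 2) (\<eta> / 5) * ?N \<le> t"
  proof -
    have "min (1 / 2) (\<eta> / 5) * ?N \<le> 1 / 2 * ?N" by (intro mult_right_mono) auto
    then have "min (1 / 2) (\<eta> / 5) * ?N \<le> 1" using norm_g_le[of \<gamma>] by linarith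
    moreover have "min (1 / 2) (\<eta> / 5) * ?N \<le> \<eta> / 5 * ?N" by (intro mult_right_mono) auto
    ultimately have "min (1 / 2) (\<eta> / 5) * ?N \<le> min 1 (4 / 5 * (\<eta> * ?N / 4))" by simp
    with t show ?thesis by linarith
  qed
  have "?N / k \<le> norm ?d"
    using norm_g_le_dir[OF kept] unfolding k_def[symmetric] using k by (simp add: field_simps)
  then have "(?N / k)\<^sup>2 \<le> (norm ?d)\<^sup>2" using k by (intro power_mono) auto
  then have "?N * (?N / k)\<^sup>2 \<le> ?N * (norm ?d)\<^sup>2" by (intro mult_left_mono) auto
  also have "\<dots> \<le> - (g \<gamma> \<bullet> ?d)" by (rule dir_descent[OF kept])
  finally have "(min (1 / 2) (\<eta> / 5) * ?N) * (?N * (?N / k)\<^sup>2) \<le> t * (- (g \<gamma> \<bullet> ?d))"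
    using tN \<eta>_pos by (intro mult_mono) (auto intro: order_trans[rotated])
  moreover have "decrease_const * ?N ^ 4 = 1 / 10 ^ 4 * ((min (1 / 2) (\<eta> / 5) * ?N) * (?N * (?N / k)\<^sup>2))"
    by (simp add: decrease_const_def k_def[symmetric] power_divide power2_eq_square power4_eq_xxxx)
  ultimately show ?thesis using dec by simp
qed

section \<open>Convergence of the Newton phase\<close>

theorem newton_phase_convergence:
  fixes x :: "nat \<Rightarrow> real^'n"
  assumes kept: "\<And>v. \<forall>i. i \<noteq> istar \<longrightarrow> kept_mass (\<rho> (x v)) (P (x v)) i \<noteq> 0"
    and step: "\<And>v. newton_step C a b \<eta> X istar (x v) (x (Suc v))"
    and start: "(\<Sum>j\<in>UNIV. x 0 $ j) = 0"
  shows "(\<lambda>v. norm (g (x v))) \<longlonglongrightarrow> 0"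
    and "\<exists>y. is_arg_min L (\<lambda>x. (\<Sum>j\<in>UNIV. x $ j) = 0) y \<and> x \<longlonglongrightarrow> y"
proof -
  have slice: "(\<Sum>j\<in>UNIV. x v $ j) = 0" for v
    by (induction v) (use start newton_step_slice[OF kept step] in auto)
  have dec: "L (x (Suc v)) + decrease_const * norm (g (x v)) ^ 4 \<le> L (x v)" for v
    by (rule newton_step_decrease[OF kept step])
  have anti: "decseq (\<lambda>v. L (x v))"
  proof (rule decseq_SucI)
    fix v
    have "0 \<le> decrease_const * norm (g (x v)) ^ 4" using decrease_const_pos by simp
    with dec[of v] show "L (x (Suc v)) \<le> L (x v)" by linarith
  qed
  obtain B where "\<And>y. B \<le> L y" using L_bounded_below by blast
  then obtain l where l: "(\<lambda>v. L (x v)) \<longlonglongrightarrow> l" using decseq_convergent[OF anti] by metis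
  \<comment> \<open>The values of \<open>L\<close> converge, so their consecutive differences vanish
    and squeeze the guaranteed decrease.\<close>
  have "(\<lambda>v. decrease_const * norm (g (x v)) ^ 4) \<longlonglongrightarrow> 0"
  proof (rule real_tendsto_sandwich[OF _ _ tendsto_const])
    show "(\<lambda>v. L (x v) - L (x (Suc v))) \<longlonglongrightarrow> 0"
      using tendsto_diff[OF l LIMSEQ_Suc[OF l]] by simp
    show "\<forall>\<^sub>F v in sequentially. decrease_const * norm (g (x v)) ^ 4 \<le> L (x v) - L (x (Suc v))"
      using dec by (simp add: le_diff_eq add.commute)
  qed (use decrease_const_pos in simp)
  from tendsto_mult_left[OF this, of "1 / decrease_const"]
  have "(\<lambda>v. norm (g (x v)) ^ 4) \<longlonglongrightarrow> 0" using decrease_const_pos by simp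
  then show g0: "(\<lambda>v. norm (g (x v))) \<longlonglongrightarrow> 0" by simp
  then have g0': "(\<lambda>v. g (x v)) \<longlonglongrightarrow> 0" by (rule tendsto_norm_zero_cancel)
  have bdd: "bounded (range x)"
    using bounded_sublevel_slice[of "L (x 0)"]
    by (rule bounded_subset) (use slice decseqD[OF anti, of 0] in auto)
  have cluster: "is_arg_min L (\<lambda>x. (\<Sum>j\<in>UNIV. x $ j) = 0) y"
    if r: "strict_mono r" and lim: "(x \<circ> r) \<longlonglongrightarrow> y" for r y
  proof -
    have gr: "(\<lambda>v. g (x (r v))) \<longlonglongrightarrow> 0"
      using LIMSEQ_subseq_LIMSEQ[OF g0' r] by (simp add: o_def)
    have xr: "(\<lambda>v. x (r v)) \<longlonglongrightarrow> y" using lim by (simp add: o_def)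
    have "(\<lambda>v. \<Sum>j\<in>UNIV. x (r v) $ j) \<longlonglongrightarrow> (\<Sum>j\<in>UNIV. y $ j)"
      by (intro tendsto_intros xr)
    then have y: "(\<Sum>j\<in>UNIV. y $ j) = 0" by (simp add: slice LIMSEQ_const_iff)
    \<comment> \<open>Pass to the limit in the tangent inequality at \<open>x (r v)\<close>: the
      linear term vanishes because the gradients tend to 0 while \<open>z - x (r v)\<close>
      converges.\<close>
    moreover have "L y \<le> L z" if z: "(\<Sum>j\<in>UNIV. z $ j) = 0" for z
    proof (rule LIMSEQ_le_const2)
      have "(\<lambda>v. L (x (r v))) \<longlonglongrightarrow> L y"
        by (rule isCont_tendsto_compose[OF isCont_L xr])
      moreover have "(\<lambda>v. g (x (r v)) \<bullet> (z - x (r v))) \<longlonglongrightarrow> 0 \<bullet> (z - y)"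
        by (intro tendsto_intros gr xr)
      ultimately show "(\<lambda>v. L (x (r v)) + g (x (r v)) \<bullet> (z - x (r v))) \<longlonglongrightarrow> L y"
        using tendsto_add by fastforce
      have "L (x v) + g (x v) \<bullet> (z - x v) \<le> L z" for v
        using L_strict_convex_slice[OF slice z, of v] by (cases "x v = z") auto
      then show "\<exists>N. \<forall>v\<ge>N. L (x (r v)) + g (x (r v)) \<bullet> (z - x (r v)) \<le> L z" by blast
    qed
    ultimately show ?thesis by (simp add: is_arg_min_linorder)
  qed
  obtain y r where y: "strict_mono r" "(x \<circ> r) \<longlonglongrightarrow> y"
    using bounded_imp_convergent_subsequence[OF bdd] by blast
  have "x \<longlonglongrightarrow> y"
    using bdd
  proof (rule bounded_seq_tendsto)
    fix s l assume "strict_mono s" "(x \<circ> s) \<longlonglongrightarrow> l"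
    then show "l = y" using cluster y slice_minimizer_unique by blast
  qed
  then show "\<exists>y. is_arg_min L (\<lambda>x. (\<Sum>j\<in>UNIV. x $ j) = 0) y \<and> x \<longlonglongrightarrow> y"
    using cluster y by blast
qed

end

theorem theorem4p2:
  fixes C X :: "real^'n^'m" and a :: "real^'m" and b :: "real^'n" and \<eta> :: real
    and istar :: 'm and \<zeta>0 :: "real^'m" and \<gamma> :: "nat \<Rightarrow> real^'n"
  assumes "\<And>i j. C $ i $ j \<ge> 0"
    and "\<And>i. a $ i > 0" and "(\<Sum>i\<in>UNIV. a $ i) = 1"
    and "\<And>j. b $ j > 0" and "(\<Sum>j\<in>UNIV. b $ j) = 1"
    and "\<eta> > 0"
    and "\<And>i j. X $ i $ j > 0"
    and "is_arg_max (\<lambda>i. a $ i) (\<lambda>_. True) istar"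
    and "(\<Sum>j\<in>UNIV. \<gamma> 0 $ j) = 0"
    and "ibsn_inner_run C a b \<eta> X istar \<zeta>0 \<gamma>"
    and "\<And>v i. v \<ge> 1 \<Longrightarrow> i \<noteq> istar \<Longrightarrow>
           kept_mass (ibsn_rho C a b \<eta> X (\<gamma> v)) (ibsn_P C \<eta> X (\<gamma> v)) i \<noteq> 0"
  shows "(\<lambda>v. norm (ibsn_g C a b \<eta> X (\<gamma> v))) \<longlonglongrightarrow> 0
         \<and> (\<exists>\<gamma>star. is_arg_min (ibsn_L C a b \<eta> X) (\<lambda>x. (\<Sum>j\<in>UNIV. x $ j) = 0) \<gamma>star
           \<and> (\<forall>x. is_arg_min (ibsn_L C a b \<eta> X) (\<lambda>x. (\<Sum>j\<in>UNIV. x $ j) = 0) x \<longrightarrow> x = \<gamma>star)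
           \<and> \<gamma> \<longlonglongrightarrow> \<gamma>star)"
proof -
  interpret ibsn C X a b \<eta>
    by unfold_locales (simp_all add: assms(2-7))
  \<comment> \<open>The Newton phase begins at index 1, where centering has put the iterate in the
    slice; the convergence result is applied to the sequence shifted by one, which has the same
    limits.\<close>
  have start: "(\<Sum>j\<in>UNIV. \<gamma> (Suc 0) $ j) = 0"
    and step: "newton_step C a b \<eta> X istar (\<gamma> (Suc v)) (\<gamma> (Suc (Suc v)))" for v
    using assms(10) unfolding ibsn_inner_run_def by (auto simp: sum_center)
  have kept: "\<forall>i. i \<noteq> istar \<longrightarrow> kept_mass (\<rho> (\<gamma> (Suc v))) (P (\<gamma> (Suc v))) i \<noteq> 0" for v
    using assms(11) by simp
  note conv = newton_phase_convergence[of istar "\<lambda>v. \<gamma> (Suc v)", OF kept step start]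
  have "(\<lambda>v. norm (g (\<gamma> v))) \<longlonglongrightarrow> 0"
    using conv(1) by (rule filterlim_sequentially_Suc[THEN iffD1])
  moreover obtain y where "is_arg_min L (\<lambda>x. (\<Sum>j\<in>UNIV. x $ j) = 0) y" "\<gamma> \<longlonglongrightarrow> y"
    using conv(2) by (auto simp: filterlim_sequentially_Suc)
  ultimately show ?thesis using slice_minimizer_unique by blast
qed

end
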